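(* Let $(X^n)_n$ and $X$ be càdlàg processes, $\mathcal{F}^n$ the natural filtration of $X^n$ and $\mathcal{F}$ the right-continuous filtration associated to the natural filtration of $X$. Suppose that $\mathcal{F}^n\xrightarrow{w}\mathcal{F}$ (weak convergence of filtrations). Let $(\tau^n)_n$ be a sequence such that each $\tau^n$ is an $\mathcal{F}^n$-stopping time and such that $(\tau^n)_n$ converges in probability to an $\mathcal{F}_T$-measurable random variable $\tau$. Then $\tau$ is an $\mathcal{F}$-stopping time.
   Context: All processes are defined on a probability space $(\Omega,\mathcal{A},\mathbb{P})$, real-valued and indexed by $[0,T]$ with $T>0$ fixed; all filtrations are indexed by $[0,T]$. The natural filtration of a process $Y$ is $\mathcal{F}^Y_t=\sigma(Y_s,\,s\leqslant t)$. The right-continuous filtration associated to the natural filtration of $X$ is $\mathcal{F}_t=\mathcal{F}^X_{t^+}=\bigcap_{s>t}\mathcal{F}^X_s$ for $t<T$, with $\mathcal{F}_T=\mathcal{F}^X_T$. A random variable $\tau$ is an $\mathcal{F}$-stopping time if $\{\tau\leqslant t\}\in\mathcal{F}_t$ for every $t\in[0,T]$, and similarly for $\mathcal{F}^n$. Weak convergence of filtrations $\mathcal{F}^n\xrightarrow{w}\mathcal{F}$ means: for every $A\in\mathcal{F}_T$, the sequence of processes $(\mathbb{E}[1_A|\mathcal{F}^n_\cdot])_n$ converges in probability to $\mathbb{E}[1_A|\mathcal{F}_\cdot]$ for the Skorokhod ($J_1$) topology on the space of càdlàg functions $[0,T]\to\mathbb{R}$.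
   Formalization: The conclusion is that τ is almost surely equal to an F-stopping time; the literal claim fails because F is not augmented by null sets (τ may be altered on a null set of F_T that is not in the earlier F_t). *)

theory Defs
  imports "HOL-Probability.Probability"
begin

text \<open>
  Processes and filtrations indexed by \<open>[0,T]\<close> are represented by functions of a real time
  parameter; every notion below only looks at times in \<open>{0..T}\<close>. A filtration is a family of
  measures of which only the space and the sigma-algebra matter, as in the library's treatment of
  conditional expectations.
\<close>

definition cadlag_on :: "real \<Rightarrow> (real \<Rightarrow> real) \<Rightarrow> bool" where
  "cadlag_on T f \<longleftrightarrow>
     (\<forall>t\<in>{0..<T}. (f \<longlongrightarrow> f t) (at_right t)) \<and>
     (\<forall>t\<in>{0<..T}. \<exists>l. (f \<longlongrightarrow> l) (at_left t))"

definition cadlag_process :: "'a measure \<Rightarrow> real \<Rightarrow> (real \<Rightarrow> 'a \<Rightarrow> real) \<Rightarrow> bool" where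
  "cadlag_process M T Y \<longleftrightarrow>
     (\<forall>t\<in>{0..T}. Y t \<in> borel_measurable M) \<and>
     (\<forall>\<omega>\<in>space M. cadlag_on T (\<lambda>t. Y t \<omega>))"

definition natural_filtration ::
    "'a measure \<Rightarrow> (real \<Rightarrow> 'a \<Rightarrow> real) \<Rightarrow> real \<Rightarrow> 'a measure" where
  "natural_filtration M Y t =
     sigma (space M) {Y s -` B \<inter> space M | s B. s \<in> {0..t} \<and> B \<in> sets borel}"

text \<open>
  The intersection below is already a sigma-algebra; \<open>sigma\<close> only packages it as a measure. It is
  not augmented by null sets.
\<close>

definition right_cont_filtration ::
    "'a measure \<Rightarrow> real \<Rightarrow> (real \<Rightarrow> 'a \<Rightarrow> real) \<Rightarrow> real \<Rightarrow> 'a measure" where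
  "right_cont_filtration M T Y t =
     (if t < T then sigma (space M) (\<Inter>s\<in>{t<..T}. sets (natural_filtration M Y s))
      else natural_filtration M Y T)"

text \<open>
  The library's \<open>stopping_time\<close> requires the condition at every element of the index type and
  hence does not apply to the index set \<open>[0,T]\<close>.
\<close>

definition is_stopping_time ::
    "'a measure \<Rightarrow> real \<Rightarrow> (real \<Rightarrow> 'a measure) \<Rightarrow> ('a \<Rightarrow> real) \<Rightarrow> bool" where
  "is_stopping_time M T F \<tau> \<longleftrightarrow>
     \<tau> \<in> borel_measurable M \<and>
     (\<forall>t\<in>{0..T}. {\<omega>\<in>space M. \<tau> \<omega> \<le> t} \<in> sets (F t))"

definition time_changes :: "real \<Rightarrow> (real \<Rightarrow> real) set" where
  "time_changes T =
     {\<theta>. strict_mono_on {0..T} \<theta> \<and> continuous_on {0..T} \<theta> \<and> \<theta> ` {0..T} = {0..T}}"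

text \<open>
  The standard metric for the \<open>J1\<close> topology. It is taken in \<open>ennreal\<close> so that suprema and infima
  are meaningful without boundedness side conditions; on cadlag functions it is finite.
\<close>

definition J1_dist :: "real \<Rightarrow> (real \<Rightarrow> real) \<Rightarrow> (real \<Rightarrow> real) \<Rightarrow> ennreal" where
  "J1_dist T x y =
     (INF \<theta>\<in>time_changes T.
        max (SUP t\<in>{0..T}. ennreal \<bar>\<theta> t - t\<bar>)
            (SUP t\<in>{0..T}. ennreal \<bar>x t - y (\<theta> t)\<bar>))"

text \<open>
  For cadlag processes the event below is measurable, and then the outer measure is its
  probability (\<open>outer_measure_of_eq\<close>). Using \<open>measure\<close> or \<open>emeasure\<close> directly would instead assign
  \<open>0\<close> to any set not known to be measurable.
\<close>

definition J1_tendsto_in_prob ::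
    "'a measure \<Rightarrow> real \<Rightarrow> (nat \<Rightarrow> real \<Rightarrow> 'a \<Rightarrow> real) \<Rightarrow> (real \<Rightarrow> 'a \<Rightarrow> real) \<Rightarrow> bool" where
  "J1_tendsto_in_prob M T Yn Y \<longleftrightarrow>
     (\<forall>\<epsilon>>0. (\<lambda>n. outer_measure_of M
        {\<omega>\<in>space M. ennreal \<epsilon> < J1_dist T (\<lambda>t. Yn n t \<omega>) (\<lambda>t. Y t \<omega>)}) \<longlonglongrightarrow> 0)"

text \<open>
  \<open>N\<close> is a cadlag version of the process of conditional probabilities of \<open>A\<close> given \<open>F t\<close>. Such a
  version is unique up to indistinguishability. It is not required to be adapted, because without
  null sets in the filtration a version with all paths cadlag need not be adapted.
\<close>

definition cadlag_cond_prob ::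
    "'a measure \<Rightarrow> real \<Rightarrow> (real \<Rightarrow> 'a measure) \<Rightarrow> 'a set \<Rightarrow> (real \<Rightarrow> 'a \<Rightarrow> real) \<Rightarrow> bool" where
  "cadlag_cond_prob M T F A N \<longleftrightarrow>
     cadlag_process M T N \<and>
     (\<forall>t\<in>{0..T}. AE \<omega> in M. N t \<omega> = real_cond_exp M (F t) (indicator A) \<omega>)"

text \<open>
  Convergence in the Skorokhod space presupposes that the conditional probability processes have
  cadlag versions; hence the existential quantifiers. By uniqueness the choice of the versions is
  irrelevant.
\<close>

definition weakly_converging_filtrations ::
    "'a measure \<Rightarrow> real \<Rightarrow> (nat \<Rightarrow> real \<Rightarrow> 'a measure) \<Rightarrow> (real \<Rightarrow> 'a measure) \<Rightarrow> bool" where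
  "weakly_converging_filtrations M T Fn F \<longleftrightarrow>
     (\<forall>A\<in>sets (F T). \<exists>Nn N.
        (\<forall>n. cadlag_cond_prob M T (Fn n) A (Nn n)) \<and>
        cadlag_cond_prob M T F A N \<and>
        J1_tendsto_in_prob M T Nn N)"

text \<open>
  A limit in probability is determined only almost surely, whereas the filtrations above contain no
  null sets beyond those generated by the processes. The assertion that such a limit \<open>\<tau>\<close> is a
  stopping time is therefore stated up to almost sure equality. The pointwise assertion
  \<open>is_stopping_time M T F \<tau>\<close> can fail: take the unit mass at \<open>True\<close> on the booleans, let
  \<open>X t \<omega> = 1\<close> if \<open>t \<ge> T/2\<close> and \<open>\<omega> = False\<close>, and \<open>X t \<omega> = 0\<close> otherwise; let every \<open>X\<^sup>n\<close> be
  \<open>0\<close>, every \<open>\<tau>\<^sup>n\<close> be \<open>T/2\<close>, and \<open>\<tau> = T/2\<close> at \<open>True\<close> but \<open>\<tau> = T/4\<close> at \<open>False\<close>. Then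
  \<open>{\<tau> \<le> T/4} = {False}\<close> does not belong to the trivial sigma-algebra at time \<open>T/4\<close>.
\<close>

end

theory Submission
  imports Defs
begin

text \<open>
  Fix \<open>t < T\<close>, write \<open>A = {\<tau> \<le> t}\<close>, and let \<open>N\<^sup>n\<close> and \<open>N\<close> be the processes of conditional
  probabilities of \<open>A\<close> given \<open>\<F>\<^sup>n\<close> and \<open>\<F>\<close>. If \<open>s > t\<close>, then \<open>{\<tau>\<^sup>n > s}\<close> belongs to \<open>\<F>\<^sup>n\<^sub>s\<close>, hence
  the integral of \<open>N\<^sup>n\<^sub>s\<close> over this event equals \<open>P(\<tau> \<le> t, \<tau>\<^sup>n > s)\<close>, which tends to \<open>0\<close> because
  \<open>\<tau>\<^sup>n\<close> converges to \<open>\<tau>\<close> in probability. So \<open>N\<^sup>n\<^sub>s\<close> becomes small on \<open>{\<tau>\<^sup>n > s}\<close>.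

  This smallness passes to \<open>N\<^sub>t\<close> on \<open>{\<tau> > t}\<close>. A time change moves \<open>s\<close> only a little, so
  Skorokhod closeness of \<open>N\<^sup>n\<close> and \<open>N\<close> bounds \<open>N\<^sup>n\<^sub>s\<close> from below, up to a small error, by the infimum
  of \<open>N\<close> over a short interval around \<open>s\<close>. Thus \<open>N\<close> cannot stay above a positive level on an
  interval \<open>]t, t + 2h[\<close> while \<open>\<tau> > t + 2h\<close> (\<open>AE_not_excursion\<close>). Since \<open>N\<close> is right-continuous,
  letting \<open>h\<close> decrease to \<open>0\<close> gives \<open>N\<^sub>t \<le> 0\<close> almost surely on \<open>{\<tau> > t}\<close>
  (\<open>AE_limit_cond_prob_nonpos\<close>). The comparison uses whole intervals because evaluation
  at a fixed time is not continuous for the Skorokhod topology at paths that jump there.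

  The conditional probability of \<open>A\<close> given \<open>\<F>\<^sub>t\<close> therefore vanishes off \<open>A\<close>, and it is positive
  almost everywhere on \<open>A\<close>; so \<open>A\<close> agrees almost surely with the \<open>\<F>\<^sub>t\<close>-measurable set where it
  is positive (\<open>ae_eq_set_in_subalgebra\<close>). Finally, the sets obtained for rational \<open>t\<close> are, up to
  null sets, the sublevel sets of a random time, which right-continuity of \<open>\<F>\<close> makes a stopping time
  (\<open>stopping_time_version\<close>).
\<close>

section \<open>The Skorokhod distance\<close>

text \<open>
  The only information about time changes that the limit argument uses: a value of \<open>x\<close> is close to
  some value of \<open>y\<close> at a nearby time. The infimum defining the distance need not be attained,
  whence the slightly larger bound \<open>d\<close>.
\<close>

lemma J1_dist_leD:
  assumes "J1_dist T x y \<le> ennreal \<delta>" and "0 \<le> \<delta>" and "\<delta> < d" and "s \<in> {0..T}"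
  obtains u where "u \<in> {0..T}" and "\<bar>u - s\<bar> < d" and "\<bar>x s - y u\<bar> < d"
proof -
  have "J1_dist T x y < ennreal d"
    using assms(1) ennreal_lessI[of d \<delta>] assms(2,3) by (simp add: order_le_less_trans)
  then obtain \<theta> where \<theta>: "\<theta> \<in> time_changes T"
    and less: "max (SUP t\<in>{0..T}. ennreal \<bar>\<theta> t - t\<bar>) (SUP t\<in>{0..T}. ennreal \<bar>x t - y (\<theta> t)\<bar>)
                 < ennreal d"
    unfolding J1_dist_def by (auto simp: INF_less_iff)
  have "ennreal \<bar>\<theta> s - s\<bar> \<le> (SUP t\<in>{0..T}. ennreal \<bar>\<theta> t - t\<bar>)"
    "ennreal \<bar>x s - y (\<theta> s)\<bar> \<le> (SUP t\<in>{0..T}. ennreal \<bar>x t - y (\<theta> t)\<bar>)"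
    using assms(4) by (auto intro!: SUP_upper)
  then have "ennreal \<bar>\<theta> s - s\<bar> < ennreal d" "ennreal \<bar>x s - y (\<theta> s)\<bar> < ennreal d"
    using less by (auto intro: order_le_less_trans)
  then have "\<bar>\<theta> s - s\<bar> < d" "\<bar>x s - y (\<theta> s)\<bar> < d"
    by (simp_all add: ennreal_less_iff)
  moreover have "\<theta> s \<in> {0..T}"
    using \<theta> assms(4) unfolding time_changes_def by blast
  ultimately show ?thesis by (intro that)
qed

section \<open>Conditional probabilities\<close>

context finite_measure_subalgebra
begin

lemma set_integral_cond_prob:
  assumes "A \<in> sets M" and "S \<in> sets F"
  shows "(\<integral>\<omega>\<in>S. real_cond_exp M F (indicator A) \<omega> \<partial>M) = measure M (A \<inter> S)"
proof -
  have S: "S \<in> sets M" using assms(2) subalg unfolding subalgebra_def by auto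
  have "integrable M (indicator A :: 'a \<Rightarrow> real)"
    using assms(1) by (simp add: emeasure_finite less_top[symmetric])
  from real_cond_exp_intA[OF this assms(2)]
  have "(\<integral>\<omega>\<in>S. real_cond_exp M F (indicator A) \<omega> \<partial>M) = (\<integral>\<omega>\<in>S. indicator A \<omega> \<partial>M)" by simp
  also have "\<dots> = (\<integral>\<omega>. indicator (A \<inter> S) \<omega> \<partial>M)"
    unfolding set_lebesgue_integral_def
    by (intro Bochner_Integration.integral_cong) (auto simp: indicator_def)
  also have "\<dots> = measure M (A \<inter> S)"
    using assms(1) S by simp
  finally show ?thesis .
qed

lemma integrable_cond_prob:
  assumes "A \<in> sets M"
  shows "integrable M (real_cond_exp M F (indicator A))"
  using assms by (intro real_cond_exp_int) (simp add: emeasure_finite less_top[symmetric])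

text \<open>
  The part of \<open>S\<close> where the conditional probability is at least \<open>\<eta>\<close> is itself in \<open>F\<close>, so that the
  defining identity applies to it directly.
\<close>

lemma cond_prob_Markov:
  assumes "A \<in> sets M" and "S \<in> sets F"
  shows "\<eta> * measure M {\<omega>\<in>S. \<eta> \<le> real_cond_exp M F (indicator A) \<omega>} \<le> measure M (A \<inter> S)"
proof -
  let ?c = "real_cond_exp M F (indicator A)"
  define R where "R = {\<omega>\<in>S. \<eta> \<le> ?c \<omega>}"
  have "R = S \<inter> {\<omega>\<in>space F. \<eta> \<le> ?c \<omega>}"
    using sets.sets_into_space[OF assms(2)] unfolding R_def by auto
  then have R: "R \<in> sets F" using assms(2) by simp
  then have RM: "R \<in> sets M" using subalg unfolding subalgebra_def by auto
  have SM: "S \<in> sets M" using assms(2) subalg unfolding subalgebra_def by auto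
  have "\<eta> * measure M R = (\<integral>\<omega>\<in>R. \<eta> \<partial>M)"
    using RM unfolding set_lebesgue_integral_def by simp
  also have "\<dots> \<le> (\<integral>\<omega>\<in>R. ?c \<omega> \<partial>M)"
    using RM integrable_cond_prob[OF assms(1)]
    by (intro set_integral_mono) (auto simp: R_def set_integrable_def emeasure_finite
        less_top[symmetric] intro!: integrable_mult_indicator[where 'b = real, simplified])
  also have "\<dots> = measure M (A \<inter> R)"
    by (rule set_integral_cond_prob[OF assms(1) R])
  also have "\<dots> \<le> measure M (A \<inter> S)"
    using assms(1) SM by (intro finite_measure_mono) (auto simp: R_def)
  finally show ?thesis unfolding R_def .
qed

text \<open>
  Over the event \<open>R\<close> where the conditional probability is nonpositive, its integral is at once
  \<open>P(A \<inter> R) \<ge> 0\<close> and at most \<open>0\<close>.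
\<close>

lemma AE_cond_prob_pos:
  assumes "A \<in> sets M"
  shows "AE \<omega> in M. \<omega> \<in> A \<longrightarrow> 0 < real_cond_exp M F (indicator A) \<omega>"
proof -
  let ?c = "real_cond_exp M F (indicator A)"
  define R where "R = {\<omega>\<in>space F. ?c \<omega> \<le> 0}"
  have R: "R \<in> sets F" unfolding R_def by simp
  then have RM: "R \<in> sets M" using subalg unfolding subalgebra_def by auto
  have "measure M (A \<inter> R) = (\<integral>\<omega>\<in>R. ?c \<omega> \<partial>M)"
    using set_integral_cond_prob[OF assms R] by simp
  also have "\<dots> = (\<integral>\<omega>. - (indicator R \<omega> * - ?c \<omega>) \<partial>M)"
    unfolding set_lebesgue_integral_def by simp
  also have "\<dots> \<le> 0"
    unfolding Bochner_Integration.integral_minus neg_le_0_iff_le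
    by (rule integral_nonneg_AE) (auto simp: R_def indicator_def)
  finally have "measure M (A \<inter> R) = 0" by (simp add: measure_le_0_iff)
  then have "A \<inter> R \<in> null_sets M"
    using assms RM by (intro null_setsI) (auto simp: emeasure_eq_measure)
  from AE_not_in[OF this] show ?thesis
    using AE_space by eventually_elim (use subalg in \<open>auto simp: R_def subalgebra_def\<close>)
qed

text \<open>
  Together with the previous lemma, vanishing off \<open>A\<close> makes the conditional probability decide
  membership in \<open>A\<close> through its sign.
\<close>

lemma ae_eq_set_in_subalgebra:
  assumes "A \<in> sets M" and "AE \<omega> in M. \<omega> \<notin> A \<longrightarrow> real_cond_exp M F (indicator A) \<omega> \<le> 0"
  obtains B where "B \<in> sets F" and "AE \<omega> in M. \<omega> \<in> B \<longleftrightarrow> \<omega> \<in> A"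
proof
  show "{\<omega>\<in>space F. 0 < real_cond_exp M F (indicator A) \<omega>} \<in> sets F" by simp
  show "AE \<omega> in M. \<omega> \<in> {\<omega>\<in>space F. 0 < real_cond_exp M F (indicator A) \<omega>} \<longleftrightarrow> \<omega> \<in> A"
    using AE_cond_prob_pos[OF assms(1)] assms(2) AE_space
    by eventually_elim (use subalg in \<open>auto simp: subalgebra_def\<close>)
qed

end

section \<open>Passage to the limit\<close>

text \<open>
  On the event in question three things can happen for each \<open>n\<close>: \<open>\<tau>\<^sup>n\<close> is far from \<open>\<tau>\<close>
  (\<open>D n\<close>), the paths of \<open>N\<^sup>n\<close> and \<open>N\<close> are far apart (\<open>G n\<close>), or else \<open>\<tau>\<^sup>n > t + h\<close> although the
  conditional probability of \<open>{\<tau> \<le> t}\<close> at time \<open>t + h\<close> is at least \<open>\<eta> / 2\<close> (\<open>K n\<close>). By Markov's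
  inequality the last event is at most \<open>2 / \<eta>\<close> times as likely as \<open>\<tau> \<le> t\<close> and \<open>\<tau>\<^sup>n > t + h\<close> together.
  All three probabilities tend to \<open>0\<close>, while the event itself does not
  depend on \<open>n\<close>. It is given by uncountably many conditions, but it lies in the intersection \<open>C\<close> of
  the measurable covers, which is a null set.
\<close>

lemma AE_not_excursion:
  assumes "prob_space M" and t: "0 \<le> t" and h: "0 < h" "t + 2 * h \<le> T" and \<eta>: "0 < \<eta>"
    and sub: "\<And>n s. s \<in> {0..T} \<Longrightarrow> subalgebra M (Fn n s)"
    and stop: "\<And>n. is_stopping_time M T (Fn n) (\<tau>n n)"
    and \<tau>[measurable]: "\<tau> \<in> borel_measurable M"
    and conv: "\<And>\<epsilon>::real. \<epsilon> > 0 \<Longrightarrow>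
           (\<lambda>n. measure M {\<omega>\<in>space M. \<epsilon> < \<bar>\<tau>n n \<omega> - \<tau> \<omega>\<bar>}) \<longlonglongrightarrow> 0"
    and Nn: "\<And>n. cadlag_cond_prob M T (Fn n) {\<omega>\<in>space M. \<tau> \<omega> \<le> t} (Nn n)"
    and J1: "J1_tendsto_in_prob M T Nn N"
  shows "AE \<omega> in M. \<not> (t + 2 * h < \<tau> \<omega> \<and> (\<forall>u\<in>{t<..<t + 2 * h}. \<eta> \<le> N u \<omega>))"
proof -
  interpret prob_space M by fact
  define A where "A = {\<omega>\<in>space M. \<tau> \<omega> \<le> t}"
  (* s is the midpoint of the interval, so that a shift by less than h keeps it inside; the extra
     factor 1/2 in \<delta> leaves room for the infimum in J1_dist not being attained *)
  define s where "s = t + h"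
  define \<delta> where "\<delta> = min h (\<eta> / 2) / 2"
  have \<delta>: "0 < \<delta>" "\<delta> < min h (\<eta> / 2)" using h \<eta> by (auto simp: \<delta>_def)
  have s: "s \<in> {0..T}" using t h by (auto simp: s_def)
  have A[measurable]: "A \<in> sets M" unfolding A_def by measurable
  have \<tau>n[measurable]: "\<tau>n n \<in> borel_measurable M" for n
    using stop[of n] by (simp add: is_stopping_time_def)
  define c where "c n = real_cond_exp M (Fn n s) (indicator A)" for n
  have c[measurable]: "c n \<in> borel_measurable M" for n unfolding c_def by simp
  have Nn_meas[measurable]: "Nn n s \<in> borel_measurable M" for n
    using Nn[of n] s by (simp add: cadlag_cond_prob_def cadlag_process_def)
  have Nn_c: "AE \<omega> in M. Nn n s \<omega> = c n \<omega>" for n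
    using Nn[of n] s unfolding c_def A_def cadlag_cond_prob_def by blast

  define D where "D n = {\<omega>\<in>space M. h / 2 < \<bar>\<tau>n n \<omega> - \<tau> \<omega>\<bar>}" for n
  define K where "K n = {\<omega>\<in>space M. s < \<tau>n n \<omega> \<and> \<eta> / 2 \<le> Nn n s \<omega>}" for n
  have D[measurable]: "D n \<in> sets M" for n unfolding D_def by measurable
  have K[measurable]: "K n \<in> sets M" for n unfolding K_def by measurable
  have D_lim: "(\<lambda>n. measure M (D n)) \<longlonglongrightarrow> 0"
    unfolding D_def using conv[of "h / 2"] h by simp

  have K_le: "measure M (K n) \<le> measure M (D n) / (\<eta> / 2)" for n
  proof -
    interpret Fn: finite_measure_subalgebra M "Fn n s"
      using sub[OF s] by unfold_locales
    define S where "S = {\<omega>\<in>space M. s < \<tau>n n \<omega>}"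
    have "S = space M - {\<omega>\<in>space M. \<tau>n n \<omega> \<le> s}" by (auto simp: S_def)
    moreover have "{\<omega>\<in>space M. \<tau>n n \<omega> \<le> s} \<in> sets (Fn n s)"
      using stop[of n] s by (auto simp: is_stopping_time_def)
    moreover have "space (Fn n s) = space M" using sub[OF s] by (simp add: subalgebra_def)
    ultimately have S: "S \<in> sets (Fn n s)"
      by (metis sets.compl_sets)
    have "measure M (K n) = measure M {\<omega>\<in>S. \<eta> / 2 \<le> c n \<omega>}"
    proof (rule measure_eq_AE)
      show "AE \<omega> in M. \<omega> \<in> K n \<longleftrightarrow> \<omega> \<in> {\<omega>\<in>S. \<eta> / 2 \<le> c n \<omega>}"
        using Nn_c[of n] by eventually_elim (auto simp: K_def S_def)
      show "{\<omega>\<in>S. \<eta> / 2 \<le> c n \<omega>} \<in> sets M" unfolding S_def by simp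
    qed simp
    then have "\<eta> / 2 * measure M (K n) \<le> measure M (A \<inter> S)"
      using Fn.cond_prob_Markov[OF A S, of "\<eta> / 2"] by (simp add: c_def)
    also have "\<dots> \<le> measure M (D n)"
      using h by (intro finite_measure_mono) (auto simp: A_def S_def D_def s_def)
    finally show ?thesis using \<eta> by (simp add: field_simps)
  qed
  have K_lim: "(\<lambda>n. measure M (K n)) \<longlonglongrightarrow> 0"
  proof (rule tendsto_sandwich[of "\<lambda>_. 0"])
    show "(\<lambda>n. measure M (D n) / (\<eta> / 2)) \<longlonglongrightarrow> 0"
      using tendsto_divide[OF D_lim tendsto_const[of "\<eta> / 2"]] \<eta> by simp
    show "\<forall>\<^sub>F n in sequentially. measure M (K n) \<le> measure M (D n) / (\<eta> / 2)"
      using K_le by (intro always_eventually allI)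
  qed auto

  let ?J = "\<lambda>n. {\<omega>\<in>space M. ennreal \<delta> < J1_dist T (\<lambda>t. Nn n t \<omega>) (\<lambda>t. N t \<omega>)}"
  \<comment> \<open>\<open>J1_tendsto_in_prob\<close> speaks of outer measure, so \<open>?J n\<close> is replaced by a measurable hull.\<close>
  have "\<forall>n. \<exists>G\<in>sets M. ?J n \<subseteq> G \<and> outer_measure_of M (?J n) = emeasure M G"
    by (intro allI outer_measure_of_attain) auto
  then obtain G where G[measurable]: "\<And>n. G n \<in> sets M" and JG: "\<And>n. ?J n \<subseteq> G n"
    and GJ: "\<And>n. outer_measure_of M (?J n) = emeasure M (G n)"
    by metis
  have "(\<lambda>n. emeasure M (G n)) \<longlonglongrightarrow> 0"
    using J1 \<delta>(1) unfolding J1_tendsto_in_prob_def GJ[symmetric] by blast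
  then have G_lim: "(\<lambda>n. measure M (G n)) \<longlonglongrightarrow> 0"
    by (simp add: emeasure_eq_measure ennreal_0[symmetric] tendsto_ennreal_iff del: ennreal_0)

  have cover: "\<omega> \<in> D n \<union> K n \<union> G n"
    if \<omega>: "\<omega> \<in> space M" and late: "t + 2 * h < \<tau> \<omega>"
      and large: "\<forall>u\<in>{t<..<t + 2 * h}. \<eta> \<le> N u \<omega>" for n \<omega>
  proof (rule ccontr)
    assume "\<not> ?thesis"
    then have nD: "\<omega> \<notin> D n" and nK: "\<omega> \<notin> K n" and nG: "\<omega> \<notin> G n" by auto
    have "J1_dist T (\<lambda>t. Nn n t \<omega>) (\<lambda>t. N t \<omega>) \<le> ennreal \<delta>"
      using nG JG[of n] \<omega> by force
    then obtain u where u: "\<bar>u - s\<bar> < min h (\<eta> / 2)" "\<bar>Nn n s \<omega> - N u \<omega>\<bar> < min h (\<eta> / 2)"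
      using J1_dist_leD[of T _ _ \<delta> "min h (\<eta> / 2)" s] \<delta> s by (metis less_imp_le)
    then have "u \<in> {t<..<t + 2 * h}" by (auto simp: s_def)
    then have "\<eta> \<le> N u \<omega>" using large by blast
    then have "\<eta> / 2 \<le> Nn n s \<omega>" using u(2) by linarith
    moreover have "s < \<tau>n n \<omega>"
      using nD \<omega> late h(1) unfolding D_def s_def by (simp add: abs_if split: if_splits)
    ultimately show False using nK \<omega> by (simp add: K_def)
  qed
  define C where "C = (\<Inter>n. D n \<union> K n \<union> G n)"
  have C[measurable]: "C \<in> sets M" unfolding C_def by measurable
  have "measure M C \<le> 0"
  proof (rule LIMSEQ_le_const)
    show "(\<lambda>n. measure M (D n) + measure M (K n) + measure M (G n)) \<longlonglongrightarrow> 0"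
      using tendsto_add[OF tendsto_add[OF D_lim K_lim] G_lim] by simp
    have "measure M C \<le> measure M (D n) + measure M (K n) + measure M (G n)" for n
    proof -
      have "measure M C \<le> measure M (D n \<union> K n \<union> G n)"
        by (rule finite_measure_mono) (auto simp: C_def)
      also have "\<dots> \<le> measure M (D n \<union> K n) + measure M (G n)"
        by (rule measure_Un_le) auto
      also have "\<dots> \<le> measure M (D n) + measure M (K n) + measure M (G n)"
        using measure_Un_le[OF D[of n] K[of n]] by simp
      finally show ?thesis .
    qed
    then show "\<exists>n0. \<forall>n\<ge>n0. measure M C \<le> measure M (D n) + measure M (K n) + measure M (G n)"
      by blast
  qed
  then have "C \<in> null_sets M"
    by (intro null_setsI) (auto simp: emeasure_eq_measure measure_le_0_iff)
  from AE_not_in[OF this] show ?thesis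
    using AE_space by eventually_elim (use cover in \<open>auto simp: C_def\<close>)
qed

text \<open>
  If \<open>\<tau> > t\<close> and \<open>N\<^sub>t > 0\<close>, then by right-continuity one of countably many excursions excluded by
  the previous lemma takes place.
\<close>

lemma AE_limit_cond_prob_nonpos:
  assumes "prob_space M" and t: "0 \<le> t" "t < T"
    and sub: "\<And>n s. s \<in> {0..T} \<Longrightarrow> subalgebra M (Fn n s)"
    and stop: "\<And>n. is_stopping_time M T (Fn n) (\<tau>n n)"
    and \<tau>: "\<tau> \<in> borel_measurable M"
    and conv: "\<And>\<epsilon>::real. \<epsilon> > 0 \<Longrightarrow>
           (\<lambda>n. measure M {\<omega>\<in>space M. \<epsilon> < \<bar>\<tau>n n \<omega> - \<tau> \<omega>\<bar>}) \<longlonglongrightarrow> 0"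
    and Nn: "\<And>n. cadlag_cond_prob M T (Fn n) {\<omega>\<in>space M. \<tau> \<omega> \<le> t} (Nn n)"
    and N: "cadlag_process M T N"
    and J1: "J1_tendsto_in_prob M T Nn N"
  shows "AE \<omega> in M. t < \<tau> \<omega> \<longrightarrow> N t \<omega> \<le> 0"
proof -
  \<comment> \<open>A single sequence serves both as the level and, after scaling into \<open>[t, T]\<close>, as the length.\<close>
  define \<kappa> where "\<kappa> k = inverse (real (Suc k))" for k
  have \<kappa>: "0 < \<kappa> k" "\<kappa> k \<le> 1" for k by (auto simp: \<kappa>_def field_simps)
  have \<kappa>_lim: "\<kappa> \<longlonglongrightarrow> 0" unfolding \<kappa>_def by (rule LIMSEQ_inverse_real_of_nat)
  define h where "h k = (T - t) / 2 * \<kappa> k" for k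
  have h_pos: "0 < h k" for k using t \<kappa> by (simp add: h_def)
  have h_le: "t + 2 * h k \<le> T" for k
    using mult_left_mono[OF \<kappa>(2)[of k], of "T - t"] t unfolding h_def by argo
  have h_lim: "(\<lambda>k. t + 2 * h k) \<longlonglongrightarrow> t"
    unfolding h_def by (rule tendsto_eq_intros \<kappa>_lim refl | simp)+
  have "AE \<omega> in M. \<forall>k. \<not> (t + 2 * h k < \<tau> \<omega> \<and> (\<forall>u\<in>{t<..<t + 2 * h k}. \<kappa> k \<le> N u \<omega>))"
    unfolding AE_all_countable
    using AE_not_excursion[OF assms(1) t(1) h_pos h_le \<kappa>(1) sub stop \<tau> conv Nn J1] by blast
  then show ?thesis
    using AE_space
  proof eventually_elim
    case (elim \<omega>)
    show ?case
    proof (intro impI, rule ccontr)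
      assume late: "t < \<tau> \<omega>" and "\<not> N t \<omega> \<le> 0"
      then have "N t \<omega> / 2 < N t \<omega>" "0 < N t \<omega> / 2" by auto
      have "((\<lambda>u. N u \<omega>) \<longlongrightarrow> N t \<omega>) (at_right t)"
        using N elim(2) t by (auto simp: cadlag_process_def cadlag_on_def)
      from order_tendstoD(1)[OF this \<open>N t \<omega> / 2 < N t \<omega>\<close>]
      obtain b where b: "b > t" "\<And>u. t < u \<Longrightarrow> u < b \<Longrightarrow> N t \<omega> / 2 < N u \<omega>"
        unfolding eventually_at_right_field by blast
      have "\<forall>\<^sub>F k in sequentially. t + 2 * h k < b \<and> t + 2 * h k < \<tau> \<omega> \<and> \<kappa> k < N t \<omega> / 2"
        using order_tendstoD(2)[OF h_lim b(1)] order_tendstoD(2)[OF h_lim late]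
          order_tendstoD(2)[OF \<kappa>_lim \<open>0 < N t \<omega> / 2\<close>]
        by eventually_elim simp
      then obtain k where k: "t + 2 * h k < b" "t + 2 * h k < \<tau> \<omega>" "\<kappa> k < N t \<omega> / 2"
        by (auto dest: eventually_happens)
      then have "\<forall>u\<in>{t<..<t + 2 * h k}. \<kappa> k \<le> N u \<omega>"
        using b(2) by (force intro: less_imp_le order.strict_trans)
      then show False using elim(1) k(2) by blast
    qed
  qed
qed

section \<open>Filtrations and stopping times\<close>

lemma space_natural_filtration [simp]: "space (natural_filtration M Y t) = space M"
  unfolding natural_filtration_def by (rule space_measure_of) auto

lemma sets_natural_filtration:
  "sets (natural_filtration M Y t) =
     sigma_sets (space M) {Y s -` B \<inter> space M | s B. s \<in> {0..t} \<and> B \<in> sets borel}"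
  unfolding natural_filtration_def by (rule sets_measure_of) auto

lemma sets_natural_filtration_mono:
  assumes "s \<le> t"
  shows "sets (natural_filtration M Y s) \<subseteq> sets (natural_filtration M Y t)"
  unfolding sets_natural_filtration
proof (rule sigma_sets_mono', rule subsetI)
  fix S assume "S \<in> {Y r -` B \<inter> space M | r B. r \<in> {0..s} \<and> B \<in> sets borel}"
  then obtain r B where "S = Y r -` B \<inter> space M" "r \<in> {0..s}" "B \<in> sets borel" by blast
  then show "S \<in> {Y r -` B \<inter> space M | r B. r \<in> {0..t} \<and> B \<in> sets borel}"
    using assms by (intro CollectI exI[of _ r] exI[of _ B]) auto
qed

lemma subalgebra_natural_filtration:
  assumes "\<And>s. s \<in> {0..t} \<Longrightarrow> Y s \<in> borel_measurable M"
  shows "subalgebra M (natural_filtration M Y t)"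
  unfolding subalgebra_def sets_natural_filtration
  using assms by (auto intro!: sets.sigma_sets_subset measurable_sets)

lemma INT_sets_natural_filtration_subset_Pow:
  assumes "t < T"
  shows "(\<Inter>s\<in>{t<..T}. sets (natural_filtration M Y s)) \<subseteq> Pow (space M)"
proof -
  have "(\<Inter>s\<in>{t<..T}. sets (natural_filtration M Y s)) \<subseteq> sets (natural_filtration M Y T)"
    using assms by (intro INT_lower) auto
  also have "\<dots> \<subseteq> Pow (space M)"
    using sets.space_closed[of "natural_filtration M Y T"] by simp
  finally show ?thesis .
qed

lemma space_right_cont_filtration [simp]: "space (right_cont_filtration M T Y t) = space M"
  using INT_sets_natural_filtration_subset_Pow[of t T M Y]
  by (cases "t < T") (simp_all add: right_cont_filtration_def space_measure_of)

lemma sets_right_cont_filtration: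
  assumes "t < T"
  shows "sets (right_cont_filtration M T Y t) =
           (\<Inter>s\<in>{t<..T}. sets (natural_filtration M Y s))"
proof -
  let ?I = "\<Inter>s\<in>{t<..T}. sets (natural_filtration M Y s)"
  have "sigma_sets (space M) ?I \<subseteq> sets (natural_filtration M Y s)" if "s \<in> {t<..T}" for s
  proof -
    have "?I \<subseteq> sets (natural_filtration M Y s)" using that by blast
    from sets.sigma_sets_subset[OF this] show ?thesis by simp
  qed
  then have "sigma_sets (space M) ?I = ?I"
    by (intro equalityI INT_greatest sigma_sets_superset_generator)
  then show ?thesis
    using assms INT_sets_natural_filtration_subset_Pow[OF assms, of M Y]
    by (simp add: right_cont_filtration_def sets_measure_of)
qed

lemma sets_right_cont_filtration_mono:
  assumes "s < u" and "u \<le> T"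
  shows "sets (right_cont_filtration M T Y s) \<subseteq> sets (natural_filtration M Y u)"
  using assms by (subst sets_right_cont_filtration) auto

lemma subalgebra_right_cont_filtration:
  assumes "\<And>s. s \<in> {0..T} \<Longrightarrow> Y s \<in> borel_measurable M" and "t \<le> T"
  shows "subalgebra M (right_cont_filtration M T Y t)"
proof -
  have "sets (right_cont_filtration M T Y t) \<subseteq> sets (natural_filtration M Y T)"
  proof (cases "t < T")
    case True
    then show ?thesis by (intro sets_right_cont_filtration_mono) auto
  qed (simp add: right_cont_filtration_def)
  then show ?thesis
    using subalgebra_natural_filtration[of T Y M] assms(1) unfolding subalgebra_def by auto
qed

text \<open>
  The exceptional null sets of the versions \<open>B t\<close> of \<open>{\<tau> \<le> t}\<close> can be discarded together only for countably
  many \<open>t\<close>, so the random time \<open>\<rho>\<close> is built from the rational ones alone: it is the infimum of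
  the rational \<open>q\<close> whose \<open>B q\<close> contains the sample point. Then \<open>{\<rho> < u}\<close> is a countable union
  of sets known before \<open>u\<close>, and right-continuity of the filtration handles \<open>{\<rho> \<le> t}\<close>.

  Almost surely \<open>\<rho>\<close> is \<open>\<tau>\<close> truncated to \<open>[0,T]\<close>. As \<open>\<tau>\<close> may take values outside this
  interval, these values are restored where \<open>\<rho>\<close> equals \<open>0\<close> or \<open>T\<close>; this does not change any of the
  events \<open>{\<rho> \<le> t}\<close> with \<open>0 \<le> t < T\<close>.
\<close>

lemma stopping_time_version:
  assumes T: "0 < T"
    and X: "\<And>s. s \<in> {0..T} \<Longrightarrow> X s \<in> borel_measurable M"
    and \<tau>: "\<tau> \<in> borel_measurable (right_cont_filtration M T X T)"
    and ae: "\<And>t. t \<in> {0..<T} \<Longrightarrow>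
      \<exists>B\<in>sets (right_cont_filtration M T X t). AE \<omega> in M. \<omega> \<in> B \<longleftrightarrow> \<tau> \<omega> \<le> t"
  shows "\<exists>\<sigma>. is_stopping_time M T (right_cont_filtration M T X) \<sigma> \<and>
             (AE \<omega> in M. \<sigma> \<omega> = \<tau> \<omega>)"
proof -
  let ?F = "right_cont_filtration M T X"
  obtain B where B: "\<And>t. t \<in> {0..<T} \<Longrightarrow> B t \<in> sets (?F t)"
    and B_ae: "\<And>t. t \<in> {0..<T} \<Longrightarrow> AE \<omega> in M. \<omega> \<in> B t \<longleftrightarrow> \<tau> \<omega> \<le> t"
    using ae by metis
  define Q where "Q = \<rat> \<inter> {0..<T}"
  have Q: "countable Q" "0 \<in> Q" "Q \<subseteq> {0..<T}"
    using T by (auto simp: Q_def countable_rat)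
  \<comment> \<open>Inserting \<open>T\<close> keeps the infimum meaningful where no rational before \<open>T\<close> qualifies.\<close>
  define E where "E \<omega> = insert T {q\<in>Q. \<omega> \<in> B q}" for \<omega>
  define \<rho> where "\<rho> \<omega> = Inf (E \<omega>)" for \<omega>
  have E: "E \<omega> \<noteq> {}" "bdd_below (E \<omega>)" "E \<omega> \<subseteq> {0..T}" for \<omega>
    using Q(3) T by (auto simp: E_def intro!: bdd_belowI[of _ 0])
  have \<rho>_bounds: "0 \<le> \<rho> \<omega>" "\<rho> \<omega> \<le> T" for \<omega>
    using E[of \<omega>] unfolding \<rho>_def
    by (auto intro!: cInf_greatest cInf_lower simp: E_def)
  have \<rho>_less: "\<rho> \<omega> < u \<longleftrightarrow> (\<exists>q\<in>Q. q < u \<and> \<omega> \<in> B q)" if "u \<le> T" for \<omega> u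
    using that E[of \<omega>] unfolding \<rho>_def by (subst cInf_less_iff) (auto simp: E_def)
  have B_sub: "B q \<in> sets (natural_filtration M X u)" if "q \<in> Q" "q < u" "u \<le> T" for q u
    using B[of q] subsetD[OF Q(3) that(1)] that sets_right_cont_filtration_mono[of q u T M X]
    by auto
  have \<rho>_lt_sets: "{\<omega>\<in>space M. \<rho> \<omega> < u} \<in> sets (natural_filtration M X u)" if "u \<le> T" for u
  proof -
    have "{\<omega>\<in>space M. \<rho> \<omega> < u} = (\<Union>q\<in>{q\<in>Q. q < u}. B q)"
      using \<rho>_less[OF that] sets.sets_into_space[OF B_sub[OF _ _ that]] by auto
    also have "\<dots> \<in> sets (natural_filtration M X u)"
      using Q(1) B_sub that by (intro sets.countable_UN') (auto intro: countable_subset)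
    finally show ?thesis .
  qed
  have \<rho>_le_sets: "{\<omega>\<in>space M. \<rho> \<omega> \<le> t} \<in> sets (?F t)" if t: "t \<in> {0..<T}" for t
  proof -
    have "{\<omega>\<in>space M. \<rho> \<omega> \<le> t} \<in> sets (natural_filtration M X s)" if s: "s \<in> {t<..T}" for s
    proof -
      \<comment> \<open>Only levels \<open>u\<close> below \<open>s\<close> enter, so that each event is known at time \<open>s\<close>.\<close>
      have "{\<omega>\<in>space M. \<rho> \<omega> \<le> t} = (\<Inter>u\<in>\<rat> \<inter> {t<..<s}. {\<omega>\<in>space M. \<rho> \<omega> < u})"
        (is "_ = ?R")
      proof (intro equalityI subsetI)
        fix \<omega> assume \<omega>: "\<omega> \<in> ?R"
        obtain r where "r \<in> \<rat>" "t < r" "r < s" using Rats_dense_in_real[of t s] s by auto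
        then have "\<omega> \<in> space M" using \<omega> by auto
        moreover have "\<rho> \<omega> \<le> t"
        proof (rule ccontr)
          assume "\<not> ?thesis"
          then obtain u where "u \<in> \<rat>" "t < u" "u < min (\<rho> \<omega>) s"
            using Rats_dense_in_real[of t "min (\<rho> \<omega>) s"] s by auto
          moreover from this have "\<rho> \<omega> < u" using \<omega> by auto
          ultimately show False by simp
        qed
        ultimately show "\<omega> \<in> {\<omega>\<in>space M. \<rho> \<omega> \<le> t}" by simp
      qed auto
      also have "\<dots> \<in> sets (natural_filtration M X s)"
      proof (rule sets.countable_INT')
        show "countable (\<rat> \<inter> {t<..<s})" by (simp add: countable_rat)
        show "\<rat> \<inter> {t<..<s} \<noteq> {}" using Rats_dense_in_real[of t s] s by auto
        show "(\<lambda>u. {\<omega>\<in>space M. \<rho> \<omega> < u}) ` (\<rat> \<inter> {t<..<s}) \<subseteq> sets (natural_filtration M X s)"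
        proof (rule image_subsetI)
          fix u assume "u \<in> \<rat> \<inter> {t<..<s}"
          then show "{\<omega>\<in>space M. \<rho> \<omega> < u} \<in> sets (natural_filtration M X s)"
            using s \<rho>_lt_sets[of u] sets_natural_filtration_mono[of u s M X] by auto
        qed
      qed
      finally show ?thesis .
    qed
    then show ?thesis using t by (simp add: sets_right_cont_filtration)
  qed

  have FT: "?F T = natural_filtration M X T" by (simp add: right_cont_filtration_def)
  have \<rho>_meas[measurable]: "\<rho> \<in> borel_measurable (natural_filtration M X T)"
  proof (rule borel_measurableI_less)
    fix u
    have "{\<omega>\<in>space M. \<rho> \<omega> < u} = space M" if "T < u"
      using \<rho>_bounds(2) that by (auto intro: le_less_trans)
    then show "{\<omega>\<in>space (natural_filtration M X T). \<rho> \<omega> < u} \<in> sets (natural_filtration M X T)"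
      using \<rho>_lt_sets[of u] sets_natural_filtration_mono[of u T M X]
        sets.top[of "natural_filtration M X T"]
      by (cases "T < u") auto
  qed
  have \<tau>_meas[measurable]: "\<tau> \<in> borel_measurable (natural_filtration M X T)"
    using \<tau> by (simp add: FT)

  define \<sigma> where "\<sigma> \<omega> = (if \<rho> \<omega> = 0 then min (\<tau> \<omega>) 0 else if \<rho> \<omega> = T then max (\<tau> \<omega>) T else \<rho> \<omega>)"
    for \<omega>
  have \<sigma>_meas[measurable]: "\<sigma> \<in> borel_measurable (natural_filtration M X T)"
    unfolding \<sigma>_def by measurable
  have "is_stopping_time M T ?F \<sigma>"
    unfolding is_stopping_time_def
  proof (intro conjI ballI)
    show "\<sigma> \<in> borel_measurable M"
      using measurable_from_subalg[OF subalgebra_natural_filtration \<sigma>_meas] X by auto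
    fix t assume t: "t \<in> {0..T}"
    show "{\<omega>\<in>space M. \<sigma> \<omega> \<le> t} \<in> sets (?F t)"
    proof (cases "t < T")
      case True
      have "\<sigma> \<omega> \<le> t \<longleftrightarrow> \<rho> \<omega> \<le> t" for \<omega>
        using True t by (auto simp: \<sigma>_def)
      then show ?thesis using \<rho>_le_sets[of t] True t by simp
    next
      case False
      have "{\<omega>\<in>space (natural_filtration M X T). \<sigma> \<omega> \<le> T} \<in> sets (natural_filtration M X T)"
        by measurable
      then show ?thesis using False t FT by simp
    qed
  qed
  moreover have "AE \<omega> in M. \<sigma> \<omega> = \<tau> \<omega>"
  proof -
    have "AE \<omega> in M. \<forall>q\<in>Q. \<omega> \<in> B q \<longleftrightarrow> \<tau> \<omega> \<le> q"
      using B_ae Q by (auto simp: AE_ball_countable)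
    then show ?thesis
    proof eventually_elim
      case (elim \<omega>)
      have \<rho>_iff: "\<rho> \<omega> < u \<longleftrightarrow> \<tau> \<omega> < u" if "0 < u" "u \<le> T" for u
      proof -
        have "(\<exists>q\<in>Q. q < u \<and> \<tau> \<omega> \<le> q) \<longleftrightarrow> \<tau> \<omega> < u"
        proof
          assume "\<tau> \<omega> < u"
          then obtain q where "q \<in> \<rat>" "max (\<tau> \<omega>) 0 < q" "q < u"
            using Rats_dense_in_real[of "max (\<tau> \<omega>) 0" u] \<open>0 < u\<close> by auto
          then show "\<exists>q\<in>Q. q < u \<and> \<tau> \<omega> \<le> q"
            using \<open>u \<le> T\<close> by (intro bexI[of _ q]) (auto simp: Q_def)
        qed auto
        then show ?thesis using \<rho>_less[OF \<open>u \<le> T\<close>] elim by auto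
      qed
      have \<rho>_eq: "\<rho> \<omega> = max 0 (min (\<tau> \<omega>) T)"
      proof (rule antisym; rule ccontr)
        assume "\<not> \<rho> \<omega> \<le> max 0 (min (\<tau> \<omega>) T)"
        then show False using \<rho>_iff[of "\<rho> \<omega>"] \<rho>_bounds[of \<omega>] by linarith
      next
        assume "\<not> max 0 (min (\<tau> \<omega>) T) \<le> \<rho> \<omega>"
        then show False
          using \<rho>_iff[of "min (\<tau> \<omega>) T"] \<rho>_bounds[of \<omega>] by linarith
      qed
      then show ?case using T by (auto simp: \<sigma>_def max_def min_def split: if_splits)
    qed
  qed
  ultimately show ?thesis by blast
qed

section \<open>Limits of stopping times under weak convergence of filtrations\<close>

theorem proposition18:
  fixes M :: "'a measure" and T :: real
    and Xn :: "nat \<Rightarrow> real \<Rightarrow> 'a \<Rightarrow> real" and X :: "real \<Rightarrow> 'a \<Rightarrow> real"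
    and \<tau>n :: "nat \<Rightarrow> 'a \<Rightarrow> real" and \<tau> :: "'a \<Rightarrow> real"
  assumes "prob_space M" and "T > 0"
    and "\<And>n. cadlag_process M T (Xn n)" and "cadlag_process M T X"
    and "weakly_converging_filtrations M T
           (\<lambda>n. natural_filtration M (Xn n)) (right_cont_filtration M T X)"
    and "\<And>n. is_stopping_time M T (natural_filtration M (Xn n)) (\<tau>n n)"
    and "\<tau> \<in> borel_measurable (right_cont_filtration M T X T)"
    and "\<And>\<epsilon>::real. \<epsilon> > 0 \<Longrightarrow>
           (\<lambda>n. measure M {\<omega>\<in>space M. \<epsilon> < \<bar>\<tau>n n \<omega> - \<tau> \<omega>\<bar>}) \<longlonglongrightarrow> 0"
  shows "\<exists>\<sigma>. is_stopping_time M T (right_cont_filtration M T X) \<sigma> \<and>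
             (AE \<omega> in M. \<sigma> \<omega> = \<tau> \<omega>)"
proof (rule stopping_time_version)
  let ?F = "right_cont_filtration M T X"
  interpret prob_space M by fact
  show X: "X s \<in> borel_measurable M" if "s \<in> {0..T}" for s
    using assms(4) that by (simp add: cadlag_process_def)
  have subn: "subalgebra M (natural_filtration M (Xn n) s)" if "s \<in> {0..T}" for n s
    using assms(3)[of n] that
    by (intro subalgebra_natural_filtration) (auto simp: cadlag_process_def)
  have sub: "subalgebra M (?F t)" if "t \<le> T" for t
    using X that by (intro subalgebra_right_cont_filtration) auto
  have \<tau>: "\<tau> \<in> borel_measurable M"
    using measurable_from_subalg[OF sub assms(7)] by simp
  fix t assume t: "t \<in> {0..<T}"
  define A where "A = {\<omega>\<in>space M. \<tau> \<omega> \<le> t}"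
  interpret Ft: finite_measure_subalgebra M "?F t"
    using sub t by unfold_locales auto
  have "{\<omega>\<in>space (?F T). \<tau> \<omega> \<le> t} \<in> sets (?F T)"
    using assms(7) by measurable
  then have "A \<in> sets (?F T)" by (simp add: A_def)
  then obtain Nn N where Nn: "\<And>n. cadlag_cond_prob M T (natural_filtration M (Xn n)) A (Nn n)"
    and N: "cadlag_cond_prob M T ?F A N" and J1: "J1_tendsto_in_prob M T Nn N"
    using assms(5) unfolding weakly_converging_filtrations_def by blast
  have "A \<in> sets M"
    using \<open>A \<in> sets (?F T)\<close> sub[of T] by (auto simp: subalgebra_def)
  moreover have "AE \<omega> in M. \<omega> \<notin> A \<longrightarrow> real_cond_exp M (?F t) (indicator A) \<omega> \<le> 0"
  proof -
    have "AE \<omega> in M. t < \<tau> \<omega> \<longrightarrow> N t \<omega> \<le> 0"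
      using t N by (intro AE_limit_cond_prob_nonpos[OF assms(1) _ _ subn assms(6) \<tau> assms(8)
            Nn[unfolded A_def] _ J1]) (auto simp: cadlag_cond_prob_def)
    moreover have "AE \<omega> in M. N t \<omega> = real_cond_exp M (?F t) (indicator A) \<omega>"
      using N t by (auto simp: cadlag_cond_prob_def)
    ultimately show ?thesis
      using AE_space by eventually_elim (auto simp: A_def)
  qed
  ultimately obtain B where "B \<in> sets (?F t)" "AE \<omega> in M. \<omega> \<in> B \<longleftrightarrow> \<omega> \<in> A"
    by (rule Ft.ae_eq_set_in_subalgebra)
  then show "\<exists>B\<in>sets (?F t). AE \<omega> in M. \<omega> \<in> B \<longleftrightarrow> \<tau> \<omega> \<le> t"
    using AE_space by (intro bexI[of _ B]) (auto simp: A_def elim: AE_mp)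
qed (use assms in auto)

end
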